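(* Let $(\Omega,\mathcal F,\mu)$ be a probability space, $\Gamma$ a difference operator on a class $\mathcal A$ of bounded measurable functions on $\Omega$, and assume that $\mu$ satisfies a $\Gamma\mathrm{-mLSI}(\rho)$ for some $\rho>0$. Let $f\in\mathcal A$, $f\ge0$, be a $\Gamma$-$(a,b)$-self-bounded function for constants $a,b\ge0$, i.e. $\Gamma(f)^2\le af+b$. Then for all $t\ge0$ $$\mu\big(f-\mathbb E_\mu f\ge t\big)\le\exp\Big(-\frac{t^2}{2\rho\,(2a\,\mathbb E_\mu f+2b+\frac13at)}\Big).$$ If, additionally, $\lambda h\in\mathcal A$ and $\Gamma(\lambda h)=|\lambda|\Gamma(h)$ for all $h\in\mathcal A$ and $\lambda\in\mathbb R$, then for all $t\in[0,\mathbb E_\mu f]$ $$\mu\big(\mathbb E_\mu f-f\ge t\big)\le\exp\Big(-\frac{t^2}{2\rho\,(2a\,\mathbb E_\mu f+2b+\frac13at)}\Big).$$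
   Context: An operator $\Gamma$ on a class $\mathcal A$ of bounded measurable functions on a probability space $(\Omega,\mathcal F,\mu)$ is called a difference operator if (1) for all $f\in\mathcal A$, $\Gamma(f)$ is a non-negative measurable function; (2) for all $f\in\mathcal A$, $a\ge0$, $b\in\mathbb R$ we have $af+b\in\mathcal A$ and $\Gamma(af+b)=a\Gamma(f)$. $\mathbb E_\mu$ denotes expectation with respect to $\mu$, and for $h\ge0$, $\mathrm{Ent}_\mu(h)=\mathbb E_\mu h\log h-\mathbb E_\mu h\,\log(\mathbb E_\mu h)$. $\mu$ satisfies a $\Gamma\mathrm{-mLSI}(\rho)$, $\rho>0$, if $\mathrm{Ent}_\mu(e^f)\le\frac\rho2\,\mathbb E_\mu\big(\Gamma(f)^2e^f\big)$ for all $f\in\mathcal A$. Convention: $s/0=+\infty$ for $s>0$ and $0/0=0$. *)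

theory Defs
  imports "HOL-Probability.Probability"
begin

text \<open>
  Functions on the probability space are total functions on the ambient type; every
  condition on values is imposed only on \<^term>\<open>space M\<close>.
\<close>

definition difference_operator ::
  "'a measure \<Rightarrow> ('a \<Rightarrow> real) set \<Rightarrow> (('a \<Rightarrow> real) \<Rightarrow> 'a \<Rightarrow> real) \<Rightarrow> bool"
where
  "difference_operator M \<A> \<Gamma> \<longleftrightarrow>
     (\<forall>f\<in>\<A>. f \<in> borel_measurable M \<and> bounded (f ` space M)) \<and>
     (\<forall>f\<in>\<A>. \<Gamma> f \<in> borel_measurable M \<and> (\<forall>x\<in>space M. 0 \<le> \<Gamma> f x)) \<and>
     (\<forall>f\<in>\<A>. \<forall>a\<ge>0. \<forall>b.
        (\<lambda>x. a * f x + b) \<in> \<A> \<and>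
        (\<forall>x\<in>space M. \<Gamma> (\<lambda>x. a * f x + b) x = a * \<Gamma> f x))"

definition Ent :: "'a measure \<Rightarrow> ('a \<Rightarrow> real) \<Rightarrow> real" where
  "Ent M h = (\<integral>x. h x * ln (h x) \<partial>M) - (\<integral>x. h x \<partial>M) * ln (\<integral>x. h x \<partial>M)"

text \<open>
  The right-hand side is a nonnegative integral because \<^term>\<open>\<Gamma> f\<close> may be unbounded and the
  expectation infinite, in which case the inequality imposes nothing (a Bochner integral would
  silently be 0). Coercing the left-hand side by \<^const>\<open>ennreal\<close> loses nothing, as a negative
  real would satisfy the inequality anyway.
\<close>

definition mLSI ::
  "'a measure \<Rightarrow> ('a \<Rightarrow> real) set \<Rightarrow> (('a \<Rightarrow> real) \<Rightarrow> 'a \<Rightarrow> real) \<Rightarrow> real \<Rightarrow> bool"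
where
  "mLSI M \<A> \<Gamma> \<rho> \<longleftrightarrow>
     (\<forall>f\<in>\<A>. ennreal (Ent M (\<lambda>x. exp (f x)))
        \<le> ennreal (\<rho> / 2) * (\<integral>\<^sup>+x. ennreal ((\<Gamma> f x)\<^sup>2 * exp (f x)) \<partial>M))"

definition self_bounded ::
  "'a measure \<Rightarrow> (('a \<Rightarrow> real) \<Rightarrow> 'a \<Rightarrow> real) \<Rightarrow> real \<Rightarrow> real \<Rightarrow> ('a \<Rightarrow> real) \<Rightarrow> bool"
where
  "self_bounded M \<Gamma> a b f \<longleftrightarrow> (\<forall>x\<in>space M. (\<Gamma> f x)\<^sup>2 \<le> a * f x + b)"

text \<open>
  The exponential of \<open>- y\<close> for \<open>y\<close> in \<open>[0, \<infinity>]\<close>, with value 0 at \<open>\<infinity>\<close>. It is applied to quotients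
  in \<^typ>\<open>ereal\<close>, where \<open>s / 0 = \<infinity>\<close> for \<open>s > 0\<close> and \<open>0 / 0 = 0\<close>, whereas division by 0
  in \<^typ>\<open>real\<close> always yields 0.
\<close>

definition exp_neg :: "ereal \<Rightarrow> real" where
  "exp_neg y = (if y = \<infinity> then 0 else exp (- real_of_ereal y))"

lemma exp_neg_quotient:
  assumes "0 \<le> s" and "0 \<le> d"
  shows "exp_neg (ereal s / ereal d) =
           (if d = 0 then (if s = 0 then 1 else 0) else exp (- (s / d)))"
  using assms by (auto simp: exp_neg_def divide_ereal_def zero_ereal_def[symmetric] field_simps)

end

theory Submission
  imports Defs "HOL-Real_Asymp.Real_Asymp"
begin

text \<open>
  Herbst's argument. For \<open>g = f\<close> or \<open>g = - f\<close> put \<open>K l = ln (E (exp (l * g)))\<close>. Applied to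
  \<open>l * g\<close>, the modified log-Sobolev inequality and self-boundedness give
  \<open>l * K' l - K l \<le> l\<^sup>2 * (p * K' l + q)\<close> with \<open>q = \<rho> * b / 2\<close> and \<open>p = \<rho> * a / 2\<close> for \<open>f\<close>,
  \<open>p = - \<rho> * a / 2\<close> for \<open>- f\<close>. Dividing by \<open>l\<^sup>2\<close>, this says that \<open>K l / l - p * K l - q * l\<close> is
  nonincreasing in \<open>l > 0\<close>; its limit at 0 is \<open>E g\<close>. The resulting bound on \<open>K\<close> is fed into
  Chernoff's inequality. The choice \<open>l = t / (2 * w + 4 / 3 * c * t)\<close> with
  \<open>w = \<rho> * (a * E f + b) / 2\<close> and \<open>c = \<rho> * a / 2\<close> is not optimal, but it is rational and gives the
  constant \<open>1 / 3\<close>, for both tails.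
\<close>

text \<open>Quadratic Taylor remainder with a bound symmetric in the sign of \<open>y\<close>, used
  to differentiate under the integral. It needs only \<open>1 + z \<le> exp z\<close>, taken at
  \<open>z = y\<close> and at \<open>z = - y\<close>; the latter gives
  \<open>exp y - 1 \<le> y * exp y\<close>.\<close>

lemma exp_taylor1_abs_le:
  fixes y :: real
  shows "\<bar>exp y - 1 - y\<bar> \<le> y\<^sup>2 * exp \<bar>y\<bar>"
proof -
  have lo: "0 \<le> exp y - 1 - y"
    using exp_ge_add_one_self[of y] by linarith
  have "(1 - y) * exp y \<le> exp (- y) * exp y"
    using exp_ge_add_one_self[of "- y"] by (intro mult_right_mono) auto
  then have up: "exp y - 1 \<le> y * exp y"
    by (simp add: exp_minus field_simps)
  have "exp y - 1 - y \<le> y\<^sup>2 * exp \<bar>y\<bar>"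
  proof (cases "0 \<le> y")
    case True
    have "exp y - 1 - y \<le> y * (exp y - 1)"
      using up by (simp add: algebra_simps)
    also have "\<dots> \<le> y * (y * exp y)"
      using True up by (intro mult_left_mono) auto
    finally show ?thesis
      using True by (simp add: power2_eq_square algebra_simps)
  next
    case False
    have "exp y - 1 - y \<le> (- y) * (1 - exp y)"
      using up by (simp add: algebra_simps)
    also have "\<dots> \<le> (- y) * (- y)"
      using False exp_ge_add_one_self[of y] by (intro mult_left_mono) linarith+
    also have "\<dots> = y\<^sup>2 * 1"
      by (simp add: power2_eq_square)
    also have "\<dots> \<le> y\<^sup>2 * exp \<bar>y\<bar>"
      by (intro mult_left_mono) auto
    finally show ?thesis .
  qed
  with lo show ?thesis by simp
qed

context prob_space
begin

lemma
  fixes g :: "'a \<Rightarrow> real"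
  assumes g: "g \<in> borel_measurable M" and B: "\<And>x. x \<in> space M \<Longrightarrow> \<bar>g x\<bar> \<le> B"
  shows integrable_exp_bounded: "integrable M (\<lambda>x. exp (l * g x))"
    and integrable_mult_exp_bounded: "integrable M (\<lambda>x. g x * exp (l * g x))"
    and integral_exp_bounded_pos: "0 < (\<integral>x. exp (l * g x) \<partial>M)"
proof -
  have *: "\<bar>l * g x\<bar> \<le> \<bar>l\<bar> * B" if "x \<in> space M" for x
    using B[OF that] by (auto simp: abs_mult intro: mult_left_mono)
  have e: "exp (l * g x) \<le> exp (\<bar>l\<bar> * B)" "exp (- (\<bar>l\<bar> * B)) \<le> exp (l * g x)" if "x \<in> space M" for x
    using *[OF that] by (auto simp: abs_le_iff)
  show 1: "integrable M (\<lambda>x. exp (l * g x))"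
    by (rule integrable_const_bound[where B="exp (\<bar>l\<bar> * B)"]) (use e g in auto)
  show "integrable M (\<lambda>x. g x * exp (l * g x))"
  proof (rule integrable_const_bound[where B="B * exp (\<bar>l\<bar> * B)"])
    show "AE x in M. norm (g x * exp (l * g x)) \<le> B * exp (\<bar>l\<bar> * B)"
    proof (rule AE_I2)
      fix x assume x: "x \<in> space M"
      show "norm (g x * exp (l * g x)) \<le> B * exp (\<bar>l\<bar> * B)"
        using B[OF x] e(1)[OF x] by (auto simp: abs_mult intro!: mult_mono)
    qed
  qed (use g in auto)
  have "exp (- (\<bar>l\<bar> * B)) \<le> (\<integral>x. exp (l * g x) \<partial>M)"
    by (rule integral_ge_const[OF 1]) (use e in auto)
  then show "0 < (\<integral>x. exp (l * g x) \<partial>M)"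
    by (rule less_le_trans[rotated]) simp
qed

text \<open>Boundedness of \<open>g\<close> makes the pointwise first-order remainder at most
  \<open>h\<^sup>2 * C\<close> uniformly on the space, so after integration the difference quotient
  misses its limit by at most \<open>\<bar>h\<bar> * C\<close>.\<close>

lemma has_real_derivative_integral_exp:
  fixes g :: "'a \<Rightarrow> real"
  assumes g: "g \<in> borel_measurable M" and B: "\<And>x. x \<in> space M \<Longrightarrow> \<bar>g x\<bar> \<le> B"
  shows "((\<lambda>l. \<integral>x. exp (l * g x) \<partial>M) has_real_derivative (\<integral>x. g x * exp (l * g x) \<partial>M)) (at l)"
proof -
  let ?F = "\<lambda>l. \<integral>x. exp (l * g x) \<partial>M" and ?D = "\<integral>x. g x * exp (l * g x) \<partial>M"
  \<comment> \<open>\<open>B\<^sup>2 * exp B\<close> comes from the Taylor remainder at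
    \<open>h * g x\<close> with \<open>\<bar>h\<bar> \<le> 1\<close>; the last factor bounds
    \<open>exp (l * g x)\<close>.\<close>
  define C where "C = B\<^sup>2 * exp B * exp (\<bar>l\<bar> * B)"
  have int: "integrable M (\<lambda>x. exp (l * g x))" "integrable M (\<lambda>x. g x * exp (l * g x))" for l
    by (rule integrable_exp_bounded[OF g B] integrable_mult_exp_bounded[OF g B], assumption)+
  have est: "\<bar>?F (l + h) - ?F l - h * ?D\<bar> \<le> h\<^sup>2 * C" if h: "\<bar>h\<bar> \<le> 1" for h
  proof -
    let ?r = "\<lambda>x. exp ((l + h) * g x) - exp (l * g x) - h * (g x * exp (l * g x))"
    have eq: "?F (l + h) - ?F l - h * ?D = (\<integral>x. ?r x \<partial>M)"
      using int by simp
    have "\<bar>?F (l + h) - ?F l - h * ?D\<bar> \<le> (\<integral>x. \<bar>?r x\<bar> \<partial>M)"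
      unfolding eq by (rule integral_abs_bound)
    also have "\<dots> \<le> h\<^sup>2 * C"
    proof (rule integral_le_const)
      show "integrable M (\<lambda>x. \<bar>?r x\<bar>)"
        by (intro integrable_abs Bochner_Integration.integrable_diff integrable_mult_right int)
      show "AE x in M. \<bar>?r x\<bar> \<le> h\<^sup>2 * C"
      proof (rule AE_I2)
        fix x assume x: "x \<in> space M"
        have "l * g x \<le> \<bar>l\<bar> * B"
          by (rule order_trans[OF abs_ge_self]) (auto simp: abs_mult intro!: mult_left_mono B x)
        then have e: "exp (l * g x) \<le> exp (\<bar>l\<bar> * B)" by simp
        have "\<bar>h * g x\<bar> \<le> 1 * B"
          unfolding abs_mult using h B[OF x] by (intro mult_mono) auto
        then have e': "exp \<bar>h * g x\<bar> \<le> exp B" by simp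
        have sq: "(h * g x)\<^sup>2 \<le> h\<^sup>2 * B\<^sup>2"
          using power_mono[OF B[OF x], of 2]
          by (auto simp: power_mult_distrib intro!: mult_left_mono)
        have "?r x = exp (l * g x) * (exp (h * g x) - 1 - h * g x)"
          by (simp add: algebra_simps exp_add)
        then have "\<bar>?r x\<bar> = \<bar>exp (h * g x) - 1 - h * g x\<bar> * exp (l * g x)"
          by (simp add: abs_mult)
        also have "\<dots> \<le> ((h * g x)\<^sup>2 * exp \<bar>h * g x\<bar>) * exp (l * g x)"
          by (intro mult_right_mono exp_taylor1_abs_le) auto
        also have "\<dots> \<le> (h\<^sup>2 * B\<^sup>2 * exp B) * exp (\<bar>l\<bar> * B)"
          by (intro mult_mono sq e e') auto
        finally show "\<bar>?r x\<bar> \<le> h\<^sup>2 * C"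
          by (simp add: C_def algebra_simps)
      qed
    qed
    finally show ?thesis .
  qed
  have "(\<lambda>h. (?F (l + h) - ?F l) / h - ?D) \<midarrow>0\<rightarrow> 0"
  proof (rule tendsto_0_le[where K="C"])
    show "(\<lambda>h::real. h) \<midarrow>0\<rightarrow> 0" by (rule tendsto_ident_at)
    have "\<forall>\<^sub>F h in at (0::real). \<bar>h\<bar> < 1"
      using eventually_at[of "\<lambda>h::real. \<bar>h\<bar> < 1" 0 UNIV] by (auto intro!: exI[of _ 1])
    moreover have "\<forall>\<^sub>F h in at (0::real). h \<noteq> 0"
      by (simp add: eventually_at_filter)
    ultimately show "\<forall>\<^sub>F h in at 0. norm ((?F (l + h) - ?F l) / h - ?D) \<le> norm h * C"
    proof eventually_elim
      case (elim h)
      have "(?F (l + h) - ?F l) / h - ?D = (?F (l + h) - ?F l - h * ?D) / h"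
        using elim by (simp add: field_simps)
      then have "norm ((?F (l + h) - ?F l) / h - ?D) = \<bar>?F (l + h) - ?F l - h * ?D\<bar> / \<bar>h\<bar>"
        by simp
      also have "\<dots> \<le> h\<^sup>2 * C / \<bar>h\<bar>"
        using est elim by (intro divide_right_mono) auto
      also have "\<dots> = norm h * C"
        using elim by (simp add: power2_eq_square field_simps abs_if)
      finally show ?case .
    qed
  qed
  then show ?thesis
    unfolding DERIV_def by (rule LIM_zero_cancel)
qed

text \<open>The entropy hypothesis, divided by \<open>s\<^sup>2 * F s\<close>, says exactly that the
  derivative of \<open>\<Phi>\<close> at \<open>s\<close> is at most 0, so \<open>\<Phi> l\<close>
  is bounded by the limit of \<open>\<Phi>\<close> at 0. The factor \<open>1 - p * l\<close> stays
  on the left, and its sign matters only when it is divided out for Chernoff's bound.\<close>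

lemma ln_mgf_le_of_entropy:
  fixes g :: "'a \<Rightarrow> real"
  assumes g: "g \<in> borel_measurable M" and B: "\<And>x. x \<in> space M \<Longrightarrow> \<bar>g x\<bar> \<le> B"
    and ent: "\<And>l. 0 < l \<Longrightarrow>
      Ent M (\<lambda>x. exp (l * g x)) \<le> l\<^sup>2 * (\<integral>x. (p * g x + q) * exp (l * g x) \<partial>M)"
    and l: "0 < l"
  shows "ln (\<integral>x. exp (l * g x) \<partial>M) * (1 - p * l) \<le> l * expectation g + q * l\<^sup>2"
proof -
  define F where "F l = (\<integral>x. exp (l * g x) \<partial>M)" for l
  define F' where "F' l = (\<integral>x. g x * exp (l * g x) \<partial>M)" for l
  define \<Phi> where "\<Phi> s = ln (F s) / s - p * ln (F s) - q * s" for s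
  have Fpos: "0 < F s" for s
    unfolding F_def by (rule integral_exp_bounded_pos[OF g B])
  have DF: "(F has_real_derivative F' s) (at s)" for s
    using has_real_derivative_integral_exp[OF g B] unfolding F_def[abs_def] F'_def .
  have DK: "((\<lambda>s. ln (F s)) has_real_derivative F' s / F s) (at s)" for s
    by (rule derivative_eq_intros DF Fpos refl)+ (simp add: divide_simps)
  \<comment> \<open>Since \<open>ln (exp (s * g x)) = s * g x\<close>, the entropy is an expression
    in \<open>F\<close> and \<open>F'\<close> alone.\<close>
  have key: "s * F' s - F s * ln (F s) \<le> s\<^sup>2 * (p * F' s + q * F s)" if "0 < s" for s
  proof -
    have "Ent M (\<lambda>x. exp (s * g x)) = s * F' s - F s * ln (F s)"
      by (simp add: Ent_def F_def F'_def algebra_simps flip: Bochner_Integration.integral_mult_right_zero)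
    moreover have "(\<integral>x. (p * g x + q) * exp (s * g x) \<partial>M) = p * F' s + q * F s"
      unfolding F_def F'_def
      using integrable_exp_bounded[OF g B, of s] integrable_mult_exp_bounded[OF g B, of s]
      by (simp add: distrib_right mult.assoc)
    ultimately show ?thesis using ent[OF that] by simp
  qed
  have mono: "\<Phi> l \<le> \<Phi> e" if e: "0 < e" "e \<le> l" for e
  proof (rule DERIV_nonpos_imp_nonincreasing[OF e(2)])
    fix s assume "e \<le> s" "s \<le> l"
    then have s: "0 < s" using e by simp
    have D: "(\<Phi> has_real_derivative
        ((F' s / F s) * s - ln (F s)) / s\<^sup>2 - p * (F' s / F s) - q) (at s)"
      unfolding \<Phi>_def[abs_def] power2_eq_square using s
      by (intro DERIV_diff DERIV_cmult DERIV_cmult_Id) (use DERIV_divide[OF DK DERIV_ident, of s] DK[of s] in simp_all)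
    have "((F' s / F s) * s - ln (F s)) / s\<^sup>2 - p * (F' s / F s) - q
        = ((s * F' s - F s * ln (F s)) - s\<^sup>2 * (p * F' s + q * F s)) / (s\<^sup>2 * F s)"
      using s Fpos[of s] by (simp add: field_simps)
    also have "\<dots> \<le> 0"
      using key[OF s] Fpos[of s] by (intro divide_nonpos_nonneg) auto
    finally show "\<exists>y. (\<Phi> has_real_derivative y) (at s) \<and> y \<le> 0"
      using D by blast
  qed
  have F0: "F 0 = 1" "F' 0 = expectation g"
    by (simp_all add: F_def F'_def prob_space)
  \<comment> \<open>As \<open>ln (F 0) = 0\<close>, this quotient is the difference quotient of
    \<open>ln F\<close> at 0, with limit \<open>F' 0 / F 0\<close>.\<close>
  have "((\<lambda>s. ln (F s) / s) \<longlongrightarrow> expectation g) (at 0)"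
    using DK[of 0] F0 by (simp add: DERIV_def)
  moreover have "((\<lambda>s. ln (F s)) \<longlongrightarrow> 0) (at 0)"
    using DERIV_isCont[OF DK[of 0]] F0 by (simp add: isCont_def)
  ultimately have "(\<Phi> \<longlongrightarrow> expectation g - p * 0 - q * 0) (at 0)"
    unfolding \<Phi>_def[abs_def] by (intro tendsto_intros)
  then have lim: "(\<Phi> \<longlongrightarrow> expectation g) (at_right 0)"
    by (auto intro: tendsto_mono[OF at_le])
  have "\<forall>\<^sub>F e in at_right 0. \<Phi> l \<le> \<Phi> e"
    using eventually_at_right_less[of 0] eventually_at_right_real[OF l]
    by eventually_elim (use mono in auto)
  then have "\<Phi> l \<le> expectation g"
    by (intro tendsto_lowerbound[OF lim]) auto
  then have "\<Phi> l * l \<le> expectation g * l"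
    using l by (intro mult_right_mono) auto
  then show ?thesis
    using l by (simp add: \<Phi>_def F_def algebra_simps power2_eq_square)
qed

text \<open>Markov's inequality for \<open>exp (l * g)\<close>. As \<open>1 - p * l\<close> is
  positive, the bound on the logarithm can be solved for it; subtracting
  \<open>l * expectation g\<close> cancels the linear term and leaves the variance proxy
  \<open>p * expectation g + q\<close>.\<close>

lemma chernoff_of_entropy:
  fixes g :: "'a \<Rightarrow> real"
  assumes g: "g \<in> borel_measurable M" and B: "\<And>x. x \<in> space M \<Longrightarrow> \<bar>g x\<bar> \<le> B"
    and ent: "\<And>l. 0 < l \<Longrightarrow>
      Ent M (\<lambda>x. exp (l * g x)) \<le> l\<^sup>2 * (\<integral>x. (p * g x + q) * exp (l * g x) \<partial>M)"
    and l: "0 < l" "p * l < 1"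
  shows "prob {x \<in> space M. t \<le> g x - expectation g}
    \<le> exp (l\<^sup>2 * (p * expectation g + q) / (1 - p * l) - l * t)"
proof -
  let ?m = "expectation g" and ?F = "\<integral>x. exp (l * g x) \<partial>M"
  have "{x \<in> space M. t \<le> g x - ?m} = {x \<in> space M. exp (l * (t + ?m)) \<le> exp (l * g x)}"
    using l(1) by (auto simp: mult_le_cancel_left_pos le_diff_eq)
  also have "prob \<dots> \<le> ?F / exp (l * (t + ?m))"
    using integrable_exp_bounded[OF g B]
    by (intro integral_Markov_inequality_measure[where A="{}"]) auto
  also have "\<dots> = exp (ln ?F - l * (t + ?m))"
    using integral_exp_bounded_pos[OF g B] by (simp add: exp_diff)
  also have "\<dots> \<le> exp ((l * ?m + q * l\<^sup>2) / (1 - p * l) - l * (t + ?m))"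
    using ln_mgf_le_of_entropy[OF g B ent l(1)] l(2) by (simp add: pos_le_divide_eq)
  also have "(l * ?m + q * l\<^sup>2) / (1 - p * l) - l * (t + ?m)
      = l\<^sup>2 * (p * ?m + q) / (1 - p * l) - l * t"
    using l(2) by (simp add: field_simps power2_eq_square)
  finally show ?thesis .
qed

text \<open>Two slopes appear because \<open>p\<close> is negative for the lower tail: replacing it
  by the nonnegative \<open>c\<close> only increases the exponent, as \<open>0 \<le> w\<close>, and
  gives both tails the same bound.\<close>

lemma tail_bound_of_entropy:
  fixes g :: "'a \<Rightarrow> real"
  assumes g: "g \<in> borel_measurable M" and B: "\<And>x. x \<in> space M \<Longrightarrow> \<bar>g x\<bar> \<le> B"
    and ent: "\<And>l. 0 < l \<Longrightarrow>
      Ent M (\<lambda>x. exp (l * g x)) \<le> l\<^sup>2 * (\<integral>x. (p * g x + q) * exp (l * g x) \<partial>M)"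
    and p: "p \<le> c" and c: "0 \<le> c" and w: "w = p * expectation g + q" "0 \<le> w" and t: "0 \<le> t"
  shows "prob {x \<in> space M. t \<le> g x - expectation g}
    \<le> exp_neg (ereal (t\<^sup>2) / ereal (8 * w + 4 / 3 * c * t))"
proof -
  let ?P = "prob {x \<in> space M. t \<le> g x - expectation g}"
  have d: "0 \<le> 8 * w + 4 / 3 * c * t" using c w t by simp
  have chern: "?P \<le> exp (l\<^sup>2 * w / (1 - c * l) - l * t)" if l: "0 < l" "c * l < 1" for l
  proof -
    have pl: "p * l \<le> c * l" using p l by simp
    then have "0 < 1 - p * l" "1 - c * l \<le> 1 - p * l" "0 < 1 - c * l"
      using l by linarith+
    then have "l\<^sup>2 * w / (1 - p * l) \<le> l\<^sup>2 * w / (1 - c * l)"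
      using w(2) by (intro divide_left_mono mult_pos_pos mult_nonneg_nonneg zero_le_power2)
    moreover have "?P \<le> exp (l\<^sup>2 * w / (1 - p * l) - l * t)"
      unfolding w(1) using l pl
      by (intro chernoff_of_entropy[OF g B ent]) (assumption | linarith)+
    ultimately show ?thesis
      by (elim order_trans) simp
  qed
  \<comment> \<open>For \<open>t = 0\<close> the bound is 1. For \<open>t > 0\<close> and
    denominator 0 it is 0, so the event must be shown to be null.\<close>
  consider "t = 0" | "0 < t" "8 * w + 4 / 3 * c * t = 0" | "0 < t" "0 < 8 * w + 4 / 3 * c * t"
    using d t by fastforce
  then show ?thesis
  proof cases
    case 1
    then show ?thesis unfolding exp_neg_quotient[OF zero_le_power2 d] by simp
  next
    case 2
    then have [simp]: "w = 0" "c = 0"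
      using c w by (auto simp: add_nonneg_eq_0_iff)
    \<comment> \<open>With \<open>w = c = 0\<close> every \<open>l > 0\<close> is admissible and the
      exponent is \<open>- l * t\<close>; let \<open>l\<close> tend to infinity.\<close>
    have "((\<lambda>l. exp (- (l * t))) \<longlongrightarrow> 0) at_top"
      using 2(1) by real_asymp
    moreover have "\<forall>\<^sub>F l in at_top. ?P \<le> exp (- (l * t))"
      using eventually_gt_at_top[of 0] by eventually_elim (use chern in simp)
    ultimately have "?P \<le> 0"
      by (intro tendsto_lowerbound) auto
    then show ?thesis unfolding exp_neg_quotient[OF zero_le_power2 d] using 2 by simp
  next
    case 3
    \<comment> \<open>\<open>l = t / E\<close> is the Chernoff parameter and \<open>4 * G\<close>
      the target denominator. They satisfy \<open>E = G + s\<close>, which makes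
      \<open>1 - c * l\<close> equal to \<open>G / E\<close>.\<close>
    define s where "s = c * t"
    define E where "E = 2 * w + 4 / 3 * s"
    define G where "G = 2 * w + 1 / 3 * s"
    have s: "0 \<le> s" using c t by (simp add: s_def)
    have pos: "0 < E" "0 < G"
      using 3 s w by (auto simp: E_def G_def s_def[symmetric] add_nonneg_pos add_pos_nonneg mult.assoc)
    have one: "1 - c * (t / E) = G / E"
      using pos by (simp add: field_simps E_def G_def s_def)
    have "(t / E)\<^sup>2 * w / (1 - c * (t / E)) - t / E * t = - (t\<^sup>2 * (G - w) / (E * G))"
      unfolding one using pos by (simp add: field_simps power2_eq_square)
    also have "\<dots> \<le> - (t\<^sup>2 / (4 * G))"
    proof -
      \<comment> \<open>This is the origin of \<open>1 / 3\<close>: for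
        \<open>G = 2 * w + k * s\<close> and \<open>E = G + s\<close>, comparing coefficients of
        \<open>s\<close> requires \<open>k + 1 \<le> 4 * k\<close>.\<close>
      have "E \<le> 4 * (G - w)" using s w by (simp add: E_def G_def)
      then have "t\<^sup>2 * E / (4 * (E * G)) \<le> t\<^sup>2 * (4 * (G - w)) / (4 * (E * G))"
        using pos by (intro divide_right_mono mult_left_mono) auto
      moreover have "t\<^sup>2 * (4 * (G - w)) / (4 * (E * G)) = t\<^sup>2 * (G - w) / (E * G)"
        by (simp only: mult.left_commute[of _ 4] mult_divide_mult_cancel_left)
      ultimately show ?thesis using pos by simp
    qed
    finally have "exp ((t / E)\<^sup>2 * w / (1 - c * (t / E)) - t / E * t) \<le> exp (- (t\<^sup>2 / (4 * G)))"
      by simp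
    moreover have "?P \<le> exp ((t / E)\<^sup>2 * w / (1 - c * (t / E)) - t / E * t)"
    proof (rule chern)
      have "0 < 1 - c * (t / E)" unfolding one using pos by simp
      then show "c * (t / E) < 1" by simp
    qed (use 3 pos in auto)
    ultimately have "?P \<le> exp (- (t\<^sup>2 / (4 * G)))"
      by (rule order_trans[rotated])
    moreover have "8 * w + 4 / 3 * c * t = 4 * G"
      by (simp add: G_def s_def)
    ultimately show ?thesis
      unfolding exp_neg_quotient[OF zero_le_power2 d] using pos by simp
  qed
qed

text \<open>Self-boundedness replaces the possibly non-integrable square of \<open>\<Gamma>\<close>
  by an affine function of the bounded \<open>g\<close>, so the extended integral becomes a real
  one. The coefficients are generic because \<open>g = - f\<close> takes
  \<open>\<alpha> = - a\<close>.\<close>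

lemma Ent_exp_le_of_mLSI:
  fixes g :: "'a \<Rightarrow> real"
  assumes g: "g \<in> borel_measurable M" and B: "\<And>x. x \<in> space M \<Longrightarrow> \<bar>g x\<bar> \<le> B"
    and mlsi: "mLSI M \<A> \<Gamma> \<rho>" and \<rho>: "0 < \<rho>" and A: "(\<lambda>x. l * g x) \<in> \<A>"
    and \<Gamma>: "\<And>x. x \<in> space M \<Longrightarrow> (\<Gamma> (\<lambda>x. l * g x) x)\<^sup>2 \<le> l\<^sup>2 * (\<alpha> * g x + \<beta>)"
  shows "Ent M (\<lambda>x. exp (l * g x))
    \<le> l\<^sup>2 * (\<integral>x. (\<rho> * \<alpha> / 2 * g x + \<rho> * \<beta> / 2) * exp (l * g x) \<partial>M)"
proof -
  let ?h = "\<lambda>x. l\<^sup>2 * (\<alpha> * g x + \<beta>) * exp (l * g x)"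
  \<comment> \<open>The sign comes from dominating a square, since \<open>\<alpha>\<close> may be
    negative.\<close>
  have nn: "0 \<le> ?h x" if "x \<in> space M" for x
    using order_trans[OF zero_le_power2 \<Gamma>[OF that]] by (rule mult_nonneg_nonneg) simp
  have int: "integrable M ?h"
    using integrable_exp_bounded[OF g B, of l] integrable_mult_exp_bounded[OF g B, of l]
    by (simp add: distrib_right distrib_left mult.assoc)
  have "ennreal (Ent M (\<lambda>x. exp (l * g x)))
      \<le> ennreal (\<rho> / 2) * (\<integral>\<^sup>+x. ennreal ((\<Gamma> (\<lambda>x. l * g x) x)\<^sup>2 * exp (l * g x)) \<partial>M)"
    using mlsi A unfolding mLSI_def by fast
  also have "\<dots> \<le> ennreal (\<rho> / 2) * (\<integral>\<^sup>+x. ennreal (?h x) \<partial>M)"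
    using \<Gamma> by (intro mult_left_mono nn_integral_mono ennreal_leI mult_right_mono) auto
  also have "\<dots> = ennreal (\<rho> / 2 * (\<integral>x. ?h x \<partial>M))"
    using \<rho> nn by (subst nn_integral_eq_integral[OF int]) (auto simp: ennreal_mult simp flip: times_divide_eq_left)
  finally have "Ent M (\<lambda>x. exp (l * g x)) \<le> \<rho> / 2 * (\<integral>x. ?h x \<partial>M)"
    using \<rho> nn by (subst (asm) ennreal_le_iff) (auto intro!: integral_nonneg_AE)
  also have "\<dots> = (\<integral>x. \<rho> / 2 * ?h x \<partial>M)" by simp
  also have "\<dots> = (\<integral>x. l\<^sup>2 * ((\<rho> * \<alpha> / 2 * g x + \<rho> * \<beta> / 2) * exp (l * g x)) \<partial>M)"
    by (intro Bochner_Integration.integral_cong) (auto simp: algebra_simps)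
  finally show ?thesis by simp
qed

end

theorem proposition1p5:
  fixes M :: "'a measure"
    and \<A> :: "('a \<Rightarrow> real) set"
    and \<Gamma> :: "('a \<Rightarrow> real) \<Rightarrow> 'a \<Rightarrow> real"
    and f :: "'a \<Rightarrow> real"
    and \<rho> a b :: real
  assumes "prob_space M"
    and "difference_operator M \<A> \<Gamma>"
    and "\<rho> > 0"
    and "mLSI M \<A> \<Gamma> \<rho>"
    and "f \<in> \<A>"
    and "\<forall>x\<in>space M. 0 \<le> f x"
    and "a \<ge> 0" and "b \<ge> 0"
    and "self_bounded M \<Gamma> a b f"
  shows "(\<forall>t\<ge>0.
            measure M {x \<in> space M. f x - integral\<^sup>L M f \<ge> t}
              \<le> exp_neg (ereal (t\<^sup>2) / ereal (2 * \<rho> * (2 * a * integral\<^sup>L M f + 2 * b + 1 / 3 * a * t))))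
       \<and> ((\<forall>h\<in>\<A>. \<forall>c::real. (\<lambda>x. c * h x) \<in> \<A> \<and>
              (\<forall>x\<in>space M. \<Gamma> (\<lambda>x. c * h x) x = \<bar>c\<bar> * \<Gamma> h x)) \<longrightarrow>
          (\<forall>t\<in>{0..integral\<^sup>L M f}.
            measure M {x \<in> space M. integral\<^sup>L M f - f x \<ge> t}
              \<le> exp_neg (ereal (t\<^sup>2) / ereal (2 * \<rho> * (2 * a * integral\<^sup>L M f + 2 * b + 1 / 3 * a * t)))))"
proof -
  interpret prob_space M by fact
  let ?m = "integral\<^sup>L M f"
  define D where "D t = 2 * \<rho> * (2 * a * ?m + 2 * b + 1 / 3 * a * t)" for t
  have f: "f \<in> borel_measurable M"
    using assms(2,5) by (simp add: difference_operator_def)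
  have "bounded (f ` space M)"
    using assms(2,5) by (simp add: difference_operator_def)
  then obtain B where B: "\<And>x. x \<in> space M \<Longrightarrow> \<bar>f x\<bar> \<le> B"
    by (auto simp: bounded_iff)
  have m: "0 \<le> ?m"
    using assms(6) by (intro integral_nonneg_AE) auto
  \<comment> \<open>The common value of \<open>p * expectation g + q\<close> for
    \<open>g = f\<close> and \<open>g = - f\<close>: in the second case the two minus signs
    cancel.\<close>
  define w where "w = \<rho> * a / 2 * ?m + \<rho> * b / 2"
  have w: "0 \<le> w"
    using m assms(3,7,8) by (simp add: w_def)
  have D: "8 * w + 4 / 3 * (\<rho> * a / 2) * t = D t" for t
    by (simp add: w_def D_def algebra_simps)
  have sb: "(l * \<Gamma> f x)\<^sup>2 \<le> l\<^sup>2 * (a * f x + b)" if "x \<in> space M" for l x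
    using assms(9) that by (auto simp: power_mult_distrib self_bounded_def intro: mult_left_mono)
  have upper: "prob {x \<in> space M. f x - ?m \<ge> t} \<le> exp_neg (ereal (t\<^sup>2) / ereal (D t))"
    if t: "0 \<le> t" for t
  proof -
    have "Ent M (\<lambda>x. exp (l * f x))
        \<le> l\<^sup>2 * (\<integral>x. (\<rho> * a / 2 * f x + \<rho> * b / 2) * exp (l * f x) \<partial>M)" if l: "0 < l" for l
    proof (rule Ent_exp_le_of_mLSI[OF f B assms(4,3)])
      \<comment> \<open>The affine axiom with shift 0; it covers nonnegative factors only, so the
        lower tail uses the symmetry assumption with factor \<open>- l\<close>.\<close>
      have "(\<lambda>x. l * f x + 0) \<in> \<A> \<and> (\<forall>x\<in>space M. \<Gamma> (\<lambda>x. l * f x + 0) x = l * \<Gamma> f x)"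
        using assms(2,5) l unfolding difference_operator_def by (meson less_imp_le)
      then have A: "(\<lambda>x. l * f x) \<in> \<A>"
          "\<And>x. x \<in> space M \<Longrightarrow> \<Gamma> (\<lambda>x. l * f x) x = l * \<Gamma> f x"
        by auto
      then show "(\<lambda>x. l * f x) \<in> \<A>"
        "\<And>x. x \<in> space M \<Longrightarrow> (\<Gamma> (\<lambda>x. l * f x) x)\<^sup>2 \<le> l\<^sup>2 * (a * f x + b)"
        using sb by auto
    qed
    from tail_bound_of_entropy[OF f B this order_refl _ w_def w t] show ?thesis
      using assms(3,7) unfolding D by simp
  qed
  have lower: "prob {x \<in> space M. ?m - f x \<ge> t} \<le> exp_neg (ereal (t\<^sup>2) / ereal (D t))"
    if sym: "\<forall>h\<in>\<A>. \<forall>c::real. (\<lambda>x. c * h x) \<in> \<A> \<and>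
              (\<forall>x\<in>space M. \<Gamma> (\<lambda>x. c * h x) x = \<bar>c\<bar> * \<Gamma> h x)"
      and t: "0 \<le> t" for t
  proof -
    have f': "(\<lambda>x. - f x) \<in> borel_measurable M" using f by simp
    have B': "\<And>x. x \<in> space M \<Longrightarrow> \<bar>- f x\<bar> \<le> B" using B by simp
    \<comment> \<open>The self-bound \<open>a * f x + b\<close> is rewritten as
      \<open>- a * - f x + b\<close>, an affine function of \<open>- f\<close> with slope
      \<open>- a\<close>.\<close>
    have *: "Ent M (\<lambda>x. exp (l * - f x))
        \<le> l\<^sup>2 * (\<integral>x. (\<rho> * (- a) / 2 * - f x + \<rho> * b / 2) * exp (l * - f x) \<partial>M)"
      if l: "0 < l" for l
    proof (rule Ent_exp_le_of_mLSI[OF f' B' assms(4,3)])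
      have "(\<lambda>x. (- l) * f x) \<in> \<A> \<and> (\<forall>x\<in>space M. \<Gamma> (\<lambda>x. (- l) * f x) x = \<bar>- l\<bar> * \<Gamma> f x)"
        using sym assms(5) by blast
      then have A: "(\<lambda>x. l * - f x) \<in> \<A>"
          "\<And>x. x \<in> space M \<Longrightarrow> \<Gamma> (\<lambda>x. l * - f x) x = l * \<Gamma> f x"
        using l by auto
      then show "(\<lambda>x. l * - f x) \<in> \<A>"
        "\<And>x. x \<in> space M \<Longrightarrow> (\<Gamma> (\<lambda>x. l * - f x) x)\<^sup>2 \<le> l\<^sup>2 * (- a * - f x + b)"
        using sb by auto
    qed
    have "\<rho> * (- a) / 2 \<le> \<rho> * a / 2" "0 \<le> \<rho> * a / 2"
      using assms(3,7) by auto
    moreover have "w = \<rho> * (- a) / 2 * expectation (\<lambda>x. - f x) + \<rho> * b / 2"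
      by (simp add: w_def)
    ultimately have "prob {x \<in> space M. t \<le> - f x - expectation (\<lambda>x. - f x)}
        \<le> exp_neg (ereal (t\<^sup>2) / ereal (8 * w + 4 / 3 * (\<rho> * a / 2) * t))"
      using tail_bound_of_entropy[OF f' B' *] w t by blast
    then show ?thesis
      unfolding D by simp
  qed
  show ?thesis
    using upper lower unfolding D_def by auto
qed

end
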